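(* Let $G$ be a $k$-regular graph, and let $G_1,\dots,G_r$ be a homogeneous fractional decomposition of $G$ with nonnegative weights $\alpha_1,\dots,\alpha_r$. Let $H_1,\dots,H_t$ be the corresponding regular graphs, and let $s_j$ ($j\in\{1,\dots,t\}$) be the corresponding constants, i.e. for every vertex $v\in V(G)$, $$s_j=\sum_{i:\ G_i'\cong H_j,\ v\in V_i}\alpha_i .$$ Then $$\delta(G)\ \ge\ \sum_{j=1}^t \delta(H_j)\, s_j .$$
   Context: All graphs are finite and simple, with at least one vertex. The eigenvalues of a graph $G$ of order $n$ are the eigenvalues $\lambda_1(G)\ge\lambda_2(G)\ge\dots\ge\lambda_n(G)$ of its adjacency matrix, $\lambda_{\min}(G)=\lambda_n(G)$, and $\delta(G)=\lambda_{\min}(G)+\lambda_1(G)$. (If $G$ is $k$-regular, then $\lambda_1(G)=k$ and $\delta(G)=\lambda_{\min}(G)+k$.) A fractional decomposition of $G$ with weights $\alpha_i\ge 0$ ($i=1,\dots,r$) is a collection of spanning subgraphs $G_i=(V(G),E_i)$ of $G$ ($i=1,\dots,r$), whose edge sets $E_i\subseteq E(G)$ are not necessarily disjoint, such that for each edge $e\in E(G)$, $\sum_{i:\, e\in E_i}\alpha_i=1$. For each $i$, $G_i'$ denotes the graph obtained from $G_i$ by removing all isolated vertices (vertices of degree $0$), and $V_i=V(G_i')$ is the set of vertices of positive degree in $G_i$. The fractional decomposition is homogeneous if there are pairwise non-isomorphic regular graphs $H_1,\dots,H_t$ such that each $G_i'$ is isomorphic to one of $H_1,\dots,H_t$ and,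 for each $j\in\{1,\dots,t\}$, the value $s_j(v)=\sum_{i:\ G_i'\cong H_j,\ v\in V_i}\alpha_i$ is the same for every vertex $v\in V(G)$; this common value is denoted $s_j$. *)

theory Defs
  imports
    "Jordan_Normal_Form.Char_Poly"
    "HOL-Library.Multiset"
begin

record 'a sgraph =
  verts :: "'a set"
  edges :: "'a set set"

definition simple_graph :: "'a sgraph \<Rightarrow> bool" where
  "simple_graph G \<longleftrightarrow> finite (verts G) \<and> verts G \<noteq> {} \<and>
     (\<forall>e\<in>edges G. e \<subseteq> verts G \<and> card e = 2)"

definition vdegree :: "'a sgraph \<Rightarrow> 'a \<Rightarrow> nat" where
  "vdegree G v = card {e \<in> edges G. v \<in> e}"

definition regular :: "nat \<Rightarrow> 'a sgraph \<Rightarrow> bool" where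
  "regular k G \<longleftrightarrow> (\<forall>v\<in>verts G. vdegree G v = k)"

definition graph_iso :: "'a sgraph \<Rightarrow> 'b sgraph \<Rightarrow> bool" where
  "graph_iso G H \<longleftrightarrow> (\<exists>f. bij_betw f (verts G) (verts H) \<and>
     (\<forall>u\<in>verts G. \<forall>v\<in>verts G. {u, v} \<in> edges G \<longleftrightarrow> {f u, f v} \<in> edges H))"

text \<open>The adjacency matrix depends on an ordering of the vertices, here an arbitrarily chosen one;
  a different choice conjugates the matrix by a permutation and leaves the spectrum unchanged.\<close>

definition vertex_list :: "'a sgraph \<Rightarrow> 'a list" where
  "vertex_list G = (SOME vs. distinct vs \<and> set vs = verts G)"

definition adj_matrix :: "'a sgraph \<Rightarrow> real mat" where
  "adj_matrix G = (let vs = vertex_list G; n = card (verts G) in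
     mat n n (\<lambda>(i, j). if {vs ! i, vs ! j} \<in> edges G then 1 else 0))"

text \<open>The eigenvalues with algebraic multiplicity, in non-increasing order. The adjacency matrix
  is real symmetric, so all eigenvalues are real and the list has length \<open>card (verts G)\<close>.
  The index of \<open>eigval\<close> starts at 1.\<close>

definition eigvals :: "'a sgraph \<Rightarrow> real list" where
  "eigvals G = rev (sorted_list_of_multiset (proots (char_poly (adj_matrix G))))"

definition eigval :: "'a sgraph \<Rightarrow> nat \<Rightarrow> real" where
  "eigval G i = eigvals G ! (i - 1)"

definition eigval_min :: "'a sgraph \<Rightarrow> real" where
  "eigval_min G = eigval G (card (verts G))"

definition delta :: "'a sgraph \<Rightarrow> real" where
  "delta G = eigval_min G + eigval G 1"

definition spanning_subgraph :: "'a sgraph \<Rightarrow> 'a sgraph \<Rightarrow> bool" where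
  "spanning_subgraph H G \<longleftrightarrow> verts H = verts G \<and> edges H \<subseteq> edges G"

definition remove_isolated :: "'a sgraph \<Rightarrow> 'a sgraph" where
  "remove_isolated G = \<lparr>verts = {v \<in> verts G. vdegree G v > 0}, edges = edges G\<rparr>"

definition fractional_decomposition ::
    "'a sgraph \<Rightarrow> nat \<Rightarrow> (nat \<Rightarrow> 'a sgraph) \<Rightarrow> (nat \<Rightarrow> real) \<Rightarrow> bool" where
  "fractional_decomposition G r Gs \<alpha> \<longleftrightarrow>
     (\<forall>i\<in>{1..r}. \<alpha> i \<ge> 0 \<and> spanning_subgraph (Gs i) G) \<and>
     (\<forall>e\<in>edges G. (\<Sum>i | i \<in> {1..r} \<and> e \<in> edges (Gs i). \<alpha> i) = 1)"

text \<open>The graphs \<open>H j\<close> have at least one vertex, so a homogeneous decomposition contains no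
  edgeless \<open>Gs i\<close>.\<close>

definition homogeneous_fractional_decomposition ::
    "'a sgraph \<Rightarrow> nat \<Rightarrow> (nat \<Rightarrow> 'a sgraph) \<Rightarrow> (nat \<Rightarrow> real) \<Rightarrow>
     nat \<Rightarrow> (nat \<Rightarrow> 'b sgraph) \<Rightarrow> (nat \<Rightarrow> real) \<Rightarrow> bool" where
  "homogeneous_fractional_decomposition G r Gs \<alpha> t H s \<longleftrightarrow>
     fractional_decomposition G r Gs \<alpha> \<and>
     (\<forall>j\<in>{1..t}. simple_graph (H j) \<and> (\<exists>d. regular d (H j))) \<and>
     (\<forall>j\<in>{1..t}. \<forall>j'\<in>{1..t}. j \<noteq> j' \<longrightarrow> \<not> graph_iso (H j) (H j')) \<and>
     (\<forall>i\<in>{1..r}. \<exists>j\<in>{1..t}. graph_iso (remove_isolated (Gs i)) (H j)) \<and>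
     (\<forall>j\<in>{1..t}. \<forall>v\<in>verts G.
        s j = (\<Sum>i | i \<in> {1..r} \<and> graph_iso (remove_isolated (Gs i)) (H j) \<and>
                   v \<in> verts (remove_isolated (Gs i)). \<alpha> i))"

end

(* For a regular graph K on W, the minimum over x of the quotient of the signless Laplacian form
   sum_{uv in E(K)} (x_u + x_v)^2 by sum_{v in W} x_v^2 is delta K. The form is additive over
   the weighted decomposition of G, so evaluating it at an eigenvector x of the least
   eigenvalue of G and bounding the part of each G_i' from below by
   delta H_j * sum_{v in V_i} x_v^2 gives the claim, since the weights of the G_i' isomorphic
   to H_j add up to s_j at every vertex. *)
theory Submission imports Defs "HOL-Analysis.Function_Topology" begin

section \<open>Minimising a quadratic form on the unit sphere\<close>

text \<open>First-order optimality: for small \<open>e\<close> of the sign opposite to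
  \<open>b\<close> the linear term would dominate and make the expression negative.\<close>

lemma quadratic_nonneg_imp_linear_coeff_0:
  fixes b c :: real
  assumes "\<And>e. 0 \<le> 2 * e * b + e\<^sup>2 * c"
  shows "b = 0"
proof (rule ccontr)
  assume b: "b \<noteq> 0"
  \<comment> \<open>Any positive \<open>m\<close> above \<open>c\<close> will do: at
    \<open>e = - b / m\<close> the expression equals \<open>(b / m)\<^sup>2 * (c - 2 * m)\<close>,
    and \<open>c - 2 * m < - m\<close>.\<close>
  define m where "m = \<bar>c\<bar> + 1"
  have m: "m > 0" "c < m" unfolding m_def by auto
  have "0 \<le> 2 * (- b / m) * b + (- b / m)\<^sup>2 * c" by (rule assms)
  also have "\<dots> = (b / m)\<^sup>2 * (c - 2 * m)" using m by (simp add: field_simps power2_eq_square)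
  finally have "0 \<le> c - 2 * m" using b m by (simp add: zero_le_mult_iff)
  with m show False by simp
qed

text \<open>By compactness the form attains a minimum \<rho> on the unit sphere, and a minimiser
  satisfies the eigenvalue equation for \<rho>. Working with functions on \<open>V\<close> instead
  of vectors keeps the argument free of any ordering of the vertices.\<close>

lemma rayleigh_minimizer:
  fixes a :: "'a \<Rightarrow> 'a \<Rightarrow> real"
  assumes fin: "finite V" and ne: "V \<noteq> {}"
    and sym: "\<And>u v. u \<in> V \<Longrightarrow> v \<in> V \<Longrightarrow> a u v = a v u"
  shows "\<exists>x \<rho>. (\<Sum>v\<in>V. (x v)\<^sup>2) = 1 \<and>
    (\<forall>u\<in>V. (\<Sum>v\<in>V. a u v * x v) = \<rho> * x u) \<and>
    (\<forall>y. \<rho> * (\<Sum>v\<in>V. (y v)\<^sup>2) \<le> (\<Sum>u\<in>V. \<Sum>v\<in>V. a u v * y u * y v))"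
proof -
  define q where "q y = (\<Sum>u\<in>V. \<Sum>v\<in>V. a u v * y u * y v)" for y :: "'a \<Rightarrow> real"
  \<comment> \<open>Functions live on the whole type, so coordinates outside \<open>V\<close> are
    pinned to 0. On the unit sphere every coordinate in \<open>V\<close> lies in [-1, 1] anyway; the
    box makes \<open>K\<close> a closed subset of a product of compact sets.\<close>
  define K where "K = {x. \<forall>v. x v \<in> (if v \<in> V then {-1..1} else {0::real})} \<inter>
    {x. (\<Sum>v\<in>V. (x v)\<^sup>2) = 1}"
  have cont: "continuous_on UNIV (\<lambda>x :: 'a \<Rightarrow> real. x v)" for v
    by (rule continuous_on_product_coordinates)
  have "compact (PiE UNIV (\<lambda>v. if v \<in> V then {-1..1} else {0::real}))"
    using compactin_PiE[of "\<lambda>_. euclidean" UNIV "\<lambda>v. if v \<in> V then {-1..1} else {0::real}"]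
    by (simp add: euclidean_product_topology)
  moreover have "closed {x :: 'a \<Rightarrow> real. (\<Sum>v\<in>V. (x v)\<^sup>2) = 1}"
    by (intro closed_Collect_eq continuous_intros continuous_on_sum continuous_on_power cont)
  ultimately have "compact K" unfolding K_def
    by (intro compact_Int_closed) (simp_all add: PiE_UNIV_domain Pi_def)
  moreover have "K \<noteq> {}"
  proof -
    obtain w where "w \<in> V" using ne by auto
    then have "(\<lambda>v. if v = w then 1 else 0) \<in> K"
      using fin unfolding K_def by (auto simp: if_distrib[of "\<lambda>z. z\<^sup>2"] cong: if_cong)
    then show ?thesis by blast
  qed
  moreover have "continuous_on K q" unfolding q_def
    by (intro continuous_on_sum continuous_on_mult continuous_on_const
        continuous_on_subset[OF cont subset_UNIV])
  ultimately have "\<exists>x\<in>K. \<forall>y\<in>K. q x \<le> q y" by (rule continuous_attains_inf)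
  then obtain x where x: "x \<in> K" and min: "\<And>y. y \<in> K \<Longrightarrow> q x \<le> q y" by blast
  define \<rho> where "\<rho> = q x"
  have norm: "(\<Sum>v\<in>V. (x v)\<^sup>2) = 1" using x unfolding K_def by simp
  have ge: "\<rho> * (\<Sum>v\<in>V. (y v)\<^sup>2) \<le> q y" for y
  proof -
    define N where "N = (\<Sum>v\<in>V. (y v)\<^sup>2)"
    have N0: "N \<ge> 0" unfolding N_def by (simp add: sum_nonneg)
    show ?thesis
    proof (cases "N = 0")
      case True
      then have "y v = 0" if "v \<in> V" for v
        using that fin unfolding N_def by (simp add: sum_nonneg_eq_0_iff)
      then show ?thesis using True unfolding q_def N_def by simp
    next
      case False
      with N0 have N: "N > 0" by simp
      \<comment> \<open>The form is homogeneous of degree 2 and sees only values on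
        \<open>V\<close>, so rescaling \<open>y\<close> and cutting it off outside \<open>V\<close>
        reduces the bound to a point of \<open>K\<close>.\<close>
      define z where "z v = (if v \<in> V then y v / sqrt N else 0)" for v
      have "(\<Sum>v\<in>V. (z v)\<^sup>2) = (\<Sum>v\<in>V. (y v)\<^sup>2 / N)"
        using N by (intro sum.cong) (auto simp: z_def power_divide)
      also have "\<dots> = 1" using N unfolding N_def by (simp add: sum_divide_distrib[symmetric])
      finally have z1: "(\<Sum>v\<in>V. (z v)\<^sup>2) = 1" .
      have "z v \<in> {-1..1}" if "v \<in> V" for v
      proof -
        have "(z v)\<^sup>2 \<le> (\<Sum>v\<in>V. (z v)\<^sup>2)" by (rule member_le_sum) (use that fin in auto)
        then have "\<bar>z v\<bar> \<le> 1" unfolding z1 by (simp add: abs_square_le_1)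
        then show ?thesis by auto
      qed
      then have "z \<in> K" using z1 unfolding K_def by (auto simp: z_def)
      then have "\<rho> \<le> q z" using min unfolding \<rho>_def by simp
      also have "q z = (\<Sum>u\<in>V. \<Sum>v\<in>V. a u v * y u * y v / N)"
        unfolding q_def using N by (intro sum.cong) (auto simp: z_def)
      also have "\<dots> = q y / N" unfolding q_def by (simp add: sum_divide_distrib)
      finally show ?thesis using N unfolding N_def[symmetric] by (simp add: field_simps)
    qed
  qed
  \<comment> \<open>Moving from the minimiser \<open>x\<close> in the direction of the residual of the eigenvalue equation
    cannot decrease the quadratic form, to first order, so the residual vanishes.\<close>
  define res where "res u = (\<Sum>v\<in>V. a u v * x v) - \<rho> * x u" for u
  \<comment> \<open>Symmetry of \<open>a\<close> makes the two mixed terms in the expansion of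
    \<open>q\<close> equal, which produces the factor 2 in the linear coefficient below.\<close>
  have swap: "(\<Sum>u\<in>V. \<Sum>v\<in>V. a u v * x u * w v) = (\<Sum>u\<in>V. \<Sum>v\<in>V. a u v * w u * x v)" for w
    by (subst sum.swap) (intro sum.cong refl, simp add: sym)
  have lin: "(\<Sum>u\<in>V. \<Sum>v\<in>V. a u v * w u * x v) - \<rho> * (\<Sum>v\<in>V. x v * w v) = (\<Sum>u\<in>V. res u * w u)" for w
    unfolding res_def
    by (simp add: sum_distrib_left sum_distrib_right sum_subtractf[symmetric] algebra_simps)
  have "(\<Sum>u\<in>V. res u * res u) = 0"
  proof (rule quadratic_nonneg_imp_linear_coeff_0)
    fix e
    have "q (\<lambda>v. x v + e * res v) = q x + e * (\<Sum>u\<in>V. \<Sum>v\<in>V. a u v * x u * res v)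
        + e * (\<Sum>u\<in>V. \<Sum>v\<in>V. a u v * res u * x v) + e\<^sup>2 * q res"
      unfolding q_def
      by (simp add: sum_distrib_left sum.distrib[symmetric] algebra_simps power2_eq_square)
    moreover have "(\<Sum>v\<in>V. (x v + e * res v)\<^sup>2) =
        1 + 2 * e * (\<Sum>v\<in>V. x v * res v) + e\<^sup>2 * (\<Sum>v\<in>V. (res v)\<^sup>2)"
      unfolding norm[symmetric]
      by (simp add: sum_distrib_left sum.distrib[symmetric] algebra_simps power2_eq_square)
    moreover note ge[of "\<lambda>v. x v + e * res v"]
    ultimately show "0 \<le> 2 * e * (\<Sum>u\<in>V. res u * res u) + e\<^sup>2 * (q res - \<rho> * (\<Sum>v\<in>V. (res v)\<^sup>2))"
      unfolding lin[symmetric] swap \<rho>_def[symmetric] by (simp add: algebra_simps)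
  qed
  then have "res u = 0" if "u \<in> V" for u
    using that fin by (simp add: sum_nonneg_eq_0_iff)
  then have "(\<Sum>v\<in>V. a u v * x v) = \<rho> * x u" if "u \<in> V" for u
    using that unfolding res_def by simp
  with norm ge show ?thesis unfolding q_def by blast
qed

section \<open>Real roots of the characteristic polynomial of a symmetric matrix\<close>

text \<open>Over the complex numbers the polynomial splits, and the roots are real because a real
  symmetric matrix is Hermitian. This is what guarantees that the real roots account for all
  \<open>n\<close> eigenvalues.\<close>

lemma real_symmetric_char_poly_splits:
  fixes A :: "real mat"
  assumes A: "A \<in> carrier_mat n n"
    and sym: "\<And>i j. i < n \<Longrightarrow> j < n \<Longrightarrow> A $$ (i, j) = A $$ (j, i)"
  shows "\<exists>rs. char_poly A = (\<Prod>r\<leftarrow>rs. [:- r, 1:]) \<and> length rs = n"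
proof -
  let ?C = "map_mat complex_of_real A"
  have C: "?C \<in> carrier_mat n n" using A by simp
  interpret mh: map_poly_inj_comm_ring_hom complex_of_real by standard
  obtain cs where cs: "char_poly ?C = (\<Prod>c\<leftarrow>cs. [:- c, 1:])" "length cs = n"
    using char_poly_factorized[OF C] by auto
  have real: "complex_of_real (Re c) = c" if "c \<in> set cs" for c
  proof -
    have "poly (char_poly ?C) c = 0" unfolding cs poly_prod_list
      using that by (force simp: prod_list_zero_iff)
    then obtain v where v: "v \<in> carrier_vec n" "v \<noteq> 0\<^sub>v n" "?C *\<^sub>v v = c \<cdot>\<^sub>v v"
      using C unfolding eigenvalue_root_char_poly[OF C, symmetric] eigenvalue_def eigenvector_def
      by auto
    define x where "x i = v $ i" for i
    have ev: "(\<Sum>j<n. complex_of_real (A $$ (i, j)) * x j) = c * x i" if "i < n" for i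
    proof -
      have "(?C *\<^sub>v v) $ i = (c \<cdot>\<^sub>v v) $ i" using v by simp
      then show ?thesis using that A v(1,2)
        by (simp add: scalar_prod_def x_def lessThan_atLeast0)
    qed
    obtain i where i: "i < n" "x i \<noteq> 0" using v unfolding x_def by (auto simp: vec_eq_iff)
    \<comment> \<open>The Hermitian form at the eigenvector: the eigenvalue equation gives
      \<open>c\<close> times the squared norm, while conjugation merely exchanges the two indices,
      so \<open>S\<close> is real.\<close>
    define S where "S = (\<Sum>i<n. \<Sum>j<n. complex_of_real (A $$ (i, j)) * x j * cnj (x i))"
    define N where "N = (\<Sum>i<n. (cmod (x i))\<^sup>2)"
    have "S = (\<Sum>i<n. c * x i * cnj (x i))" unfolding S_def
      by (intro sum.cong refl) (simp add: sum_distrib_right[symmetric] ev)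
    also have "\<dots> = c * complex_of_real N" unfolding N_def
      by (simp add: sum_distrib_left mult.assoc complex_norm_square[symmetric])
    finally have S: "S = c * complex_of_real N" .
    have "cnj S = S" unfolding S_def
      by (simp, subst sum.swap) (intro sum.cong refl, simp add: sym)
    then have "cnj c * complex_of_real N = c * complex_of_real N" unfolding S by simp
    moreover have "N \<noteq> 0"
    proof -
      have "0 < (cmod (x i))\<^sup>2" using i by simp
      also have "\<dots> \<le> N" unfolding N_def by (rule member_le_sum) (use i in auto)
      finally show ?thesis by simp
    qed
    ultimately have "cnj c = c" by simp
    then show ?thesis by (simp add: complex_eq_iff)
  qed
  \<comment> \<open>With all roots real, the complex factorisation is the image of a real one, and
    embedding the coefficients is injective.\<close>
  have "map_poly complex_of_real (char_poly A) = char_poly ?C" by (rule of_real_hom.char_poly_hom[OF A, symmetric])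
  also have "\<dots> = (\<Prod>c\<leftarrow>cs. [:- complex_of_real (Re c), 1:])"
    unfolding cs by (intro arg_cong[where f = prod_list] map_cong refl) (simp add: real)
  also have "\<dots> = map_poly complex_of_real (\<Prod>r\<leftarrow>map Re cs. [:- r, 1:])"
    by (simp add: mh.hom_prod_list o_def)
  finally have "char_poly A = (\<Prod>r\<leftarrow>map Re cs. [:- r, 1:])" by simp
  then show ?thesis using cs(2) by (intro exI[of _ "map Re cs"]) simp
qed

section \<open>Spectrum of the adjacency matrix in terms of functions on vertices\<close>

text \<open>Indexed by vertices rather than positions, so that quadratic forms do not involve the
  choice made in \<open>vertex_list\<close>.\<close>

definition adj :: "'a sgraph \<Rightarrow> 'a \<Rightarrow> 'a \<Rightarrow> real" where
  "adj G u v = (if {u, v} \<in> edges G then 1 else 0)"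

lemma adj_commute: "adj G u v = adj G v u"
  by (simp add: adj_def insert_commute)

lemma adj_nonneg: "0 \<le> adj G u v"
  by (simp add: adj_def)

lemma vertex_list:
  assumes "finite (verts G)"
  shows "distinct (vertex_list G)" "set (vertex_list G) = verts G"
    "length (vertex_list G) = card (verts G)"
proof -
  have "\<exists>vs. distinct vs \<and> set vs = verts G"
    using finite_distinct_list[OF assms] by blast
  from someI_ex[OF this] show *: "distinct (vertex_list G)" "set (vertex_list G) = verts G"
    unfolding vertex_list_def by auto
  show "length (vertex_list G) = card (verts G)"
    using distinct_card[OF *(1)] *(2) by simp
qed

lemma adj_matrix_carrier: "adj_matrix G \<in> carrier_mat (card (verts G)) (card (verts G))"
  unfolding adj_matrix_def Let_def by simp

text \<open>The vertex enumeration is a bijection from indices to vertices; composing with it turns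
  functions into vectors, reaches every vector, and respects both nonvanishing and the eigenvalue
  equation.\<close>

lemma eigenvalue_adj_matrix_iff:
  assumes "finite (verts G)"
  shows "eigenvalue (adj_matrix G) \<mu> \<longleftrightarrow>
    (\<exists>x. (\<exists>v\<in>verts G. x v \<noteq> 0) \<and> (\<forall>u\<in>verts G. (\<Sum>v\<in>verts G. adj G u v * x v) = \<mu> * x u))"
proof -
  define n where "n = card (verts G)"
  define vs where "vs = vertex_list G"
  define to_vec where "to_vec x = vec n (\<lambda>i. x (vs ! i) :: real)" for x
  have to_vec: "dim_vec (to_vec x) = n" "i < n \<Longrightarrow> to_vec x $ i = x (vs ! i)" for x i
    by (simp_all add: to_vec_def)
  note vl = vertex_list[OF assms, folded n_def vs_def]
  have bij: "bij_betw ((!) vs) {..<n} (verts G)"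
    using bij_betw_nth[OF vl(1)] vl by simp
  have nth: "vs ! i \<in> verts G" if "i < n" for i using that vl by (metis nth_mem)
  have dim: "dim_row (adj_matrix G) = n"
    using adj_matrix_carrier[of G] by (simp add: n_def)
  have mult: "(adj_matrix G *\<^sub>v to_vec x) $ i = (\<Sum>v\<in>verts G. adj G (vs ! i) v * x v)"
    if "i < n" for x i
  proof -
    have "(adj_matrix G *\<^sub>v to_vec x) $ i = (\<Sum>j<n. adj G (vs ! i) (vs ! j) * x (vs ! j))"
      using that by (simp add: adj_matrix_def Let_def scalar_prod_def to_vec_def lessThan_atLeast0
          adj_def flip: n_def vs_def)
    also have "\<dots> = (\<Sum>v\<in>verts G. adj G (vs ! i) v * x v)"
      by (rule sum.reindex_bij_betw[OF bij])
    finally show ?thesis .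
  qed
  have all: "(\<forall>u\<in>verts G. P u) \<longleftrightarrow> (\<forall>i<n. P (vs ! i))" for P
    unfolding bij_betw_imp_surj_on[OF bij, symmetric] by auto
  have eig: "eigenvector (adj_matrix G) (to_vec x) \<mu> \<longleftrightarrow>
    (\<exists>v\<in>verts G. x v \<noteq> 0) \<and> (\<forall>u\<in>verts G. (\<Sum>v\<in>verts G. adj G u v * x v) = \<mu> * x u)" for x
  proof -
    have "to_vec x \<noteq> 0\<^sub>v n \<longleftrightarrow> (\<exists>v\<in>verts G. x v \<noteq> 0)"
      using all[of "\<lambda>v. x v = 0"] by (auto simp: to_vec_def vec_eq_iff)
    moreover have "adj_matrix G *\<^sub>v to_vec x = \<mu> \<cdot>\<^sub>v to_vec x \<longleftrightarrow>
        (\<forall>u\<in>verts G. (\<Sum>v\<in>verts G. adj G u v * x v) = \<mu> * x u)"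
      unfolding all vec_eq_iff using dim
      by (simp add: mult to_vec del: index_mult_mat_vec)
    ultimately show ?thesis unfolding eigenvector_def dim by (simp add: to_vec_def)
  qed
  have surj: "\<exists>x. y = to_vec x" if "y \<in> carrier_vec n" for y
  proof -
    have "y = to_vec (\<lambda>v. y $ the_inv_into {..<n} ((!) vs) v)"
      using that bij unfolding to_vec_def bij_betw_def
      by (auto simp: vec_eq_iff the_inv_into_f_f)
    then show ?thesis by blast
  qed
  show ?thesis unfolding eigenvalue_def eig[symmetric]
    using surj dim by (metis eigenvector_def)
qed

text \<open>Links the positional definitions of the extreme eigenvalues to
  \<open>eigenvalue\<close>: since the characteristic polynomial splits, the sorted list of its
  roots has \<open>n > 0\<close> entries, and these are exactly the eigenvalues.\<close>

lemma eigval_extreme: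
  assumes "simple_graph G"
  shows "eigenvalue (adj_matrix G) (eigval_min G)"
    and "\<And>\<mu>. eigenvalue (adj_matrix G) \<mu> \<Longrightarrow> eigval_min G \<le> \<mu>"
    and "eigenvalue (adj_matrix G) (eigval G 1)"
    and "\<And>\<mu>. eigenvalue (adj_matrix G) \<mu> \<Longrightarrow> \<mu> \<le> eigval G 1"
proof -
  define n where "n = card (verts G)"
  have n: "n > 0" using assms unfolding n_def simple_graph_def by (simp add: card_gt_0_iff)
  have A: "adj_matrix G \<in> carrier_mat n n" unfolding n_def by (rule adj_matrix_carrier)
  have "adj_matrix G $$ (i, j) = adj_matrix G $$ (j, i)" if "i < n" "j < n" for i j
    using that unfolding adj_matrix_def Let_def n_def by (simp add: insert_commute)
  then obtain rs where rs: "char_poly (adj_matrix G) = (\<Prod>r\<leftarrow>rs. [:- r, 1:])" "length rs = n"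
    using real_symmetric_char_poly_splits[OF A] by auto
  have ms: "proots (char_poly (adj_matrix G)) = mset rs"
    unfolding rs(1)
  proof (induction rs)
    case (Cons a rs)
    have "(\<Prod>r\<leftarrow>rs. [:- r, 1:]) \<noteq> 0" by (auto simp: prod_list_zero_iff)
    then show ?case using Cons proots_mult[of "[:- a, 1:]" "\<Prod>r\<leftarrow>rs. [:- r, 1:]"]
      by (simp del: mult_pCons_left)
  qed simp
  define ss where "ss = sort rs"
  have ss: "eigvals G = rev ss" "sorted ss" "length ss = n" "set ss = set rs"
    unfolding ss_def eigvals_def ms using rs(2) by simp_all
  \<comment> \<open>\<open>eigvals\<close> is the reverse of the increasing list \<open>ss\<close>,
    and \<open>eigval\<close> counts from 1; so index \<open>n\<close> means position 0 of
    \<open>ss\<close>, and index 1 means position \<open>n - 1\<close>.\<close>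
  have min: "eigval_min G = ss ! 0" and max: "eigval G 1 = ss ! (n - 1)"
    using n ss(3) unfolding eigval_min_def eigval_def ss(1) n_def[symmetric]
    by (simp_all add: rev_nth)
  have ev: "eigenvalue (adj_matrix G) \<mu> \<longleftrightarrow> (\<exists>i<n. \<mu> = ss ! i)" for \<mu>
  proof -
    have "eigenvalue (adj_matrix G) \<mu> \<longleftrightarrow> \<mu> \<in> set rs"
      unfolding eigenvalue_root_char_poly[OF A] rs(1) poly_prod_list
      by (force simp: prod_list_zero_iff)
    then show ?thesis using ss by (metis in_set_conv_nth)
  qed
  show "eigenvalue (adj_matrix G) (eigval_min G)" "eigenvalue (adj_matrix G) (eigval G 1)"
    unfolding ev min max using n by (auto intro: exI[of _ "n - 1"])
  show "eigval_min G \<le> \<mu>" "\<mu> \<le> eigval G 1" if "eigenvalue (adj_matrix G) \<mu>" for \<mu>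
    using that sorted_nth_mono[OF ss(2)] ss(3) unfolding ev min max by auto
qed

section \<open>The signless Laplacian form of a regular graph\<close>

text \<open>Degrees count edges while quadratic forms produce row sums; sending a neighbour
  \<open>v\<close> to \<open>{u, v}\<close> matches the two.\<close>

lemma sum_adj_eq_vdegree:
  assumes "simple_graph G" "u \<in> verts G"
  shows "(\<Sum>v\<in>verts G. adj G u v) = vdegree G u"
proof -
  have fin: "finite (verts G)" using assms by (simp add: simple_graph_def)
  have "bij_betw (\<lambda>v. {u, v}) {v \<in> verts G. {u, v} \<in> edges G} {e \<in> edges G. u \<in> e}"
  proof (rule bij_betwI')
    fix x y
    show "({u, x} = {u, y}) = (x = y)" by (auto simp: doubleton_eq_iff)
  next
    fix e assume e: "e \<in> {e \<in> edges G. u \<in> e}"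
    then have c: "card e = 2" "e \<subseteq> verts G" using assms by (auto simp: simple_graph_def)
    then obtain a b where ab: "e = {a, b}" by (auto simp: card_2_iff)
    show "\<exists>v\<in>{v \<in> verts G. {u, v} \<in> edges G}. e = {u, v}"
    proof (cases "u = a")
      case True
      then show ?thesis using ab e c by (intro bexI[of _ b]) auto
    next
      case False
      then show ?thesis using ab e c by (intro bexI[of _ a]) (auto simp: insert_commute)
    qed
  qed auto
  then show ?thesis using fin unfolding vdegree_def adj_def
    by (simp add: bij_betw_same_card sum.If_cases Int_def)
qed

text \<open>The sum runs over ordered pairs, so every edge is counted twice.\<close>

definition signless_form :: "'a sgraph \<Rightarrow> ('a \<Rightarrow> real) \<Rightarrow> real" where
  "signless_form G x = (\<Sum>u\<in>verts G. \<Sum>v\<in>verts G. adj G u v * (x u + x v)\<^sup>2)"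

text \<open>Expanding the square, regularity turns each of the two pure square terms into
  \<open>d\<close> times the squared norm. The sign \<open>c\<close> covers the signless Laplacian
  (\<open>c = 1\<close>) and the Laplacian (\<open>c = -1\<close>) at once.\<close>

lemma regular_quadratic_form:
  assumes "simple_graph G" "regular d G" "c * c = (1 :: real)"
  shows "(\<Sum>u\<in>verts G. \<Sum>v\<in>verts G. adj G u v * (x u + c * x v)\<^sup>2) =
    2 * (d * (\<Sum>v\<in>verts G. (x v)\<^sup>2) + c * (\<Sum>u\<in>verts G. \<Sum>v\<in>verts G. adj G u v * x u * x v))"
proof -
  let ?V = "verts G"
  have deg: "(\<Sum>v\<in>?V. adj G u v) = d" if "u \<in> ?V" for u
    using sum_adj_eq_vdegree[OF assms(1) that] assms(2) that by (simp add: regular_def)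
  have 1: "(\<Sum>u\<in>?V. \<Sum>v\<in>?V. adj G u v * (x u)\<^sup>2) = d * (\<Sum>v\<in>?V. (x v)\<^sup>2)"
    by (simp add: sum_distrib_right[symmetric] deg sum_distrib_left)
  have 2: "(\<Sum>u\<in>?V. \<Sum>v\<in>?V. adj G u v * (x v)\<^sup>2) = d * (\<Sum>v\<in>?V. (x v)\<^sup>2)"
    unfolding 1[symmetric] by (subst sum.swap) (simp add: adj_commute)
  have "adj G u v * (x u + c * x v)\<^sup>2 =
      adj G u v * (x u)\<^sup>2 + adj G u v * (x v)\<^sup>2 + 2 * c * (adj G u v * x u * x v)" for u v
  proof -
    have "(x u + c * x v)\<^sup>2 = (x u)\<^sup>2 + (c * c) * (x v)\<^sup>2 + 2 * c * (x u * x v)"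
      by (simp add: power2_eq_square algebra_simps)
    then show ?thesis by (simp add: assms(3) algebra_simps)
  qed
  then show ?thesis
    by (simp add: sum.distrib sum_distrib_left[symmetric] 1 2)
qed

lemma signless_form_regular:
  assumes "simple_graph G" "regular d G"
  shows "signless_form G x =
    2 * (d * (\<Sum>v\<in>verts G. (x v)\<^sup>2) + (\<Sum>u\<in>verts G. \<Sum>v\<in>verts G. adj G u v * x u * x v))"
  using regular_quadratic_form[OF assms, of 1 x] by (simp add: signless_form_def)

lemma adj_form_eigen:
  assumes "\<And>u. u \<in> verts G \<Longrightarrow> (\<Sum>v\<in>verts G. adj G u v * x v) = \<mu> * x u"
  shows "(\<Sum>u\<in>verts G. \<Sum>v\<in>verts G. adj G u v * x u * x v) = \<mu> * (\<Sum>v\<in>verts G. (x v)\<^sup>2)"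
proof -
  have "(\<Sum>u\<in>verts G. \<Sum>v\<in>verts G. adj G u v * x u * x v)
    = (\<Sum>u\<in>verts G. x u * (\<Sum>v\<in>verts G. adj G u v * x v))"
    by (simp add: sum_distrib_left algebra_simps)
  also have "\<dots> = (\<Sum>u\<in>verts G. x u * (\<mu> * x u))"
    by (intro sum.cong refl) (simp add: assms)
  also have "\<dots> = \<mu> * (\<Sum>v\<in>verts G. (x v)\<^sup>2)"
    by (simp add: sum_distrib_left power2_eq_square algebra_simps)
  finally show ?thesis .
qed

lemma sum_squares_pos:
  fixes x :: "'a \<Rightarrow> real"
  assumes "finite V" "v \<in> V" "x v \<noteq> 0"
  shows "0 < (\<Sum>v\<in>V. (x v)\<^sup>2)"
  using assms by (intro sum_pos2[of V v]) auto

text \<open>The constant function 1 has eigenvalue \<open>d\<close>. Conversely, the Laplacian form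
  is nonnegative, and at an eigenvector for the largest eigenvalue it is
  \<open>2 * (d - eigval G 1)\<close> times the squared norm.\<close>

lemma eigval_1_regular:
  assumes G: "simple_graph G" "regular d G"
  shows "eigval G 1 = d"
proof (rule antisym)
  have fin: "finite (verts G)" and ne: "verts G \<noteq> {}" using G by (auto simp: simple_graph_def)
  have "eigenvalue (adj_matrix G) (real d)"
    unfolding eigenvalue_adj_matrix_iff[OF fin]
    using ne G by (intro exI[of _ "\<lambda>_. 1"]) (auto simp: sum_adj_eq_vdegree regular_def)
  then show "real d \<le> eigval G 1" by (rule eigval_extreme(4)[OF G(1)])
  obtain x v where x: "v \<in> verts G" "x v \<noteq> 0"
    "\<And>u. u \<in> verts G \<Longrightarrow> (\<Sum>v\<in>verts G. adj G u v * x v) = eigval G 1 * x u"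
    using eigval_extreme(3)[OF G(1)] unfolding eigenvalue_adj_matrix_iff[OF fin] by blast
  have eigen: "(\<Sum>u\<in>verts G. \<Sum>v\<in>verts G. adj G u v * x u * x v) =
      eigval G 1 * (\<Sum>v\<in>verts G. (x v)\<^sup>2)"
    by (rule adj_form_eigen) (rule x(3))
  have "0 \<le> (\<Sum>u\<in>verts G. \<Sum>v\<in>verts G. adj G u v * (x u + -1 * x v)\<^sup>2)"
    by (intro sum_nonneg mult_nonneg_nonneg adj_nonneg) simp
  also have "\<dots> = 2 * (d - eigval G 1) * (\<Sum>v\<in>verts G. (x v)\<^sup>2)"
    using regular_quadratic_form[OF G, of "-1" x]
    unfolding eigen by (simp add: algebra_simps)
  finally show "eigval G 1 \<le> d"
    using sum_squares_pos[of "verts G" v x, OF fin x(1,2)] by (simp add: zero_le_mult_iff)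
qed

text \<open>For a regular graph the signless form is the adjacency form shifted by \<open>d\<close>,
  which is the largest eigenvalue, so its minimum is governed by the least eigenvalue. The factor 2
  comes from summing over ordered pairs.\<close>

lemma delta_le_signless_form:
  assumes G: "simple_graph G" "regular d G"
  shows "2 * delta G * (\<Sum>v\<in>verts G. (x v)\<^sup>2) \<le> signless_form G x"
proof -
  have fin: "finite (verts G)" and ne: "verts G \<noteq> {}" using G by (auto simp: simple_graph_def)
  obtain y \<rho> where y: "(\<Sum>v\<in>verts G. (y v)\<^sup>2) = 1"
    "\<And>u. u \<in> verts G \<Longrightarrow> (\<Sum>v\<in>verts G. adj G u v * y v) = \<rho> * y u"
    and \<rho>: "\<And>x. \<rho> * (\<Sum>v\<in>verts G. (x v)\<^sup>2) \<le> (\<Sum>u\<in>verts G. \<Sum>v\<in>verts G. adj G u v * x u * x v)"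
    using rayleigh_minimizer[of "verts G" "adj G", OF fin ne adj_commute] by blast
  have "\<exists>v\<in>verts G. y v \<noteq> 0"
  proof (rule ccontr)
    assume "\<not> ?thesis"
    then have "(\<Sum>v\<in>verts G. (y v)\<^sup>2) = 0" by simp
    with y(1) show False by simp
  qed
  with y(2) have "eigenvalue (adj_matrix G) \<rho>"
    unfolding eigenvalue_adj_matrix_iff[OF fin] by blast
  \<comment> \<open>The minimum \<rho> of the adjacency form is itself an eigenvalue, hence bounded
    below by the least one.\<close>
  then have "eigval_min G \<le> \<rho>" by (rule eigval_extreme(2)[OF G(1)])
  then have "eigval_min G * (\<Sum>v\<in>verts G. (x v)\<^sup>2) \<le> \<rho> * (\<Sum>v\<in>verts G. (x v)\<^sup>2)"
    by (intro mult_right_mono sum_nonneg) auto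
  with \<rho>[of x] show ?thesis
    unfolding signless_form_regular[OF G] delta_def eigval_1_regular[OF G]
    by (simp add: algebra_simps)
qed

text \<open>Equality in the previous bound occurs at an eigenvector for
  \<open>eigval_min G\<close>.\<close>

lemma delta_attained:
  assumes G: "simple_graph G" "regular d G"
  obtains x where "0 < (\<Sum>v\<in>verts G. (x v)\<^sup>2)"
    and "signless_form G x = 2 * delta G * (\<Sum>v\<in>verts G. (x v)\<^sup>2)"
proof -
  have fin: "finite (verts G)" using G by (auto simp: simple_graph_def)
  obtain x v where x: "v \<in> verts G" "x v \<noteq> 0"
    "\<And>u. u \<in> verts G \<Longrightarrow> (\<Sum>v\<in>verts G. adj G u v * x v) = eigval_min G * x u"
    using eigval_extreme(1)[OF G(1)] unfolding eigenvalue_adj_matrix_iff[OF fin] by blast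
  have eigen: "(\<Sum>u\<in>verts G. \<Sum>v\<in>verts G. adj G u v * x u * x v) =
      eigval_min G * (\<Sum>v\<in>verts G. (x v)\<^sup>2)"
    by (rule adj_form_eigen) (rule x(3))
  show ?thesis
  proof (rule that)
    show "0 < (\<Sum>v\<in>verts G. (x v)\<^sup>2)" by (rule sum_squares_pos[of _ v x, OF fin x(1,2)])
    show "signless_form G x = 2 * delta G * (\<Sum>v\<in>verts G. (x v)\<^sup>2)"
      unfolding signless_form_regular[OF G] delta_def eigval_1_regular[OF G] eigen
      by (simp add: algebra_simps)
  qed
qed

section \<open>Isomorphism and removal of isolated vertices\<close>

lemma signless_form_bij:
  assumes f: "bij_betw f (verts G) (verts H)"
    and edges: "\<And>u v. u \<in> verts G \<Longrightarrow> v \<in> verts G \<Longrightarrow> {u, v} \<in> edges G \<longleftrightarrow> {f u, f v} \<in> edges H"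
  shows "signless_form G (\<lambda>v. x (f v)) = signless_form H x"
  unfolding signless_form_def sum.reindex_bij_betw[OF f, symmetric]
  by (intro sum.cong refl) (simp add: adj_def edges)

lemma signless_form_cong:
  assumes "\<And>v. v \<in> verts G \<Longrightarrow> x v = y v"
  shows "signless_form G x = signless_form G y"
  unfolding signless_form_def using assms by (intro sum.cong refl) simp

text \<open>Carrying \<open>x\<close> over to \<open>H\<close> along the isomorphism preserves both
  the form and the squared norm, so the bound for \<open>H\<close> applies without comparing
  spectra.\<close>

lemma delta_le_signless_form_iso:
  assumes iso: "graph_iso G H" and H: "simple_graph H" "regular d H"
  shows "2 * delta H * (\<Sum>v\<in>verts G. (x v)\<^sup>2) \<le> signless_form G x"
proof -
  obtain f where f: "bij_betw f (verts G) (verts H)"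
    and edges: "\<And>u v. u \<in> verts G \<Longrightarrow> v \<in> verts G \<Longrightarrow> {u, v} \<in> edges G \<longleftrightarrow> {f u, f v} \<in> edges H"
    using iso unfolding graph_iso_def by blast
  define y where "y w = x (the_inv_into (verts G) f w)" for w
  have y: "y (f v) = x v" if "v \<in> verts G" for v
    using f that unfolding y_def bij_betw_def by (simp add: the_inv_into_f_f)
  have "(\<Sum>v\<in>verts G. (x v)\<^sup>2) = (\<Sum>w\<in>verts H. (y w)\<^sup>2)"
    unfolding sum.reindex_bij_betw[OF f, symmetric] by (simp add: y)
  moreover have "signless_form G x = signless_form G (\<lambda>v. y (f v))"
    by (rule signless_form_cong) (simp add: y)
  moreover have "\<dots> = signless_form H y"
    by (rule signless_form_bij[OF f edges])
  ultimately show ?thesis using delta_le_signless_form[OF H] by simp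
qed

lemma graph_iso_sym:
  assumes "graph_iso G H"
  shows "graph_iso H G"
proof -
  obtain f where f: "bij_betw f (verts G) (verts H)"
    and edges: "\<And>u v. u \<in> verts G \<Longrightarrow> v \<in> verts G \<Longrightarrow> {u, v} \<in> edges G \<longleftrightarrow> {f u, f v} \<in> edges H"
    using assms unfolding graph_iso_def by blast
  let ?g = "the_inv_into (verts G) f"
  have g: "bij_betw ?g (verts H) (verts G)" using f by (rule bij_betw_the_inv_into)
  have "?g w \<in> verts G" "f (?g w) = w" if "w \<in> verts H" for w
    using that g f by (auto simp: bij_betw_apply f_the_inv_into_f_bij_betw)
  then show ?thesis unfolding graph_iso_def using g edges by (intro exI[of _ ?g]) simp
qed

lemma graph_iso_trans:
  assumes "graph_iso G H" "graph_iso H K"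
  shows "graph_iso G K"
proof -
  obtain f where f: "bij_betw f (verts G) (verts H)"
    and ef: "\<And>u v. u \<in> verts G \<Longrightarrow> v \<in> verts G \<Longrightarrow> {u, v} \<in> edges G \<longleftrightarrow> {f u, f v} \<in> edges H"
    using assms(1) unfolding graph_iso_def by blast
  obtain g where g: "bij_betw g (verts H) (verts K)"
    and eg: "\<And>u v. u \<in> verts H \<Longrightarrow> v \<in> verts H \<Longrightarrow> {u, v} \<in> edges H \<longleftrightarrow> {g u, g v} \<in> edges K"
    using assms(2) unfolding graph_iso_def by blast
  have "f v \<in> verts H" if "v \<in> verts G" for v using that f by (rule bij_betw_apply[rotated])
  then show ?thesis unfolding graph_iso_def using bij_betw_trans[OF f g]
    by (intro exI[of _ "g \<circ> f"]) (simp add: ef eg)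
qed

text \<open>All adjacency entries at a vertex of degree 0 vanish, so it contributes nothing to the
  form.\<close>

lemma signless_form_remove_isolated:
  assumes "simple_graph G"
  shows "signless_form (remove_isolated G) x = signless_form G x"
proof -
  have fin: "finite (verts G)" using assms by (simp add: simple_graph_def)
  have "edges G \<subseteq> Pow (verts G)" using assms by (auto simp: simple_graph_def)
  \<comment> \<open>Infinite sets have \<open>card\<close> 0, so finiteness is what makes the degree
    of an endpoint of an edge positive.\<close>
  then have finE: "finite (edges G)" using fin by (meson finite_Pow_iff finite_subset)
  have pos: "vdegree G u > 0" "vdegree G v > 0" if "{u, v} \<in> edges G" for u v
    using that finE unfolding vdegree_def by (auto simp: card_gt_0_iff)
  let ?V = "verts G" and ?W = "verts (remove_isolated G)"
  have W: "?W \<subseteq> ?V" by (auto simp: remove_isolated_def)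
  have adj: "adj (remove_isolated G) = adj G"
    by (intro ext) (simp add: adj_def remove_isolated_def)
  have z: "adj G u v = 0" if "u \<in> ?V - ?W \<or> v \<in> ?V - ?W" for u v
    using that pos[of u v] unfolding adj_def remove_isolated_def by auto
  have "(\<Sum>u\<in>?V. \<Sum>v\<in>?V. adj G u v * (x u + x v)\<^sup>2) = (\<Sum>u\<in>?W. \<Sum>v\<in>?V. adj G u v * (x u + x v)\<^sup>2)"
    using fin W by (intro sum.mono_neutral_right) (auto simp: z)
  also have "\<dots> = (\<Sum>u\<in>?W. \<Sum>v\<in>?W. adj G u v * (x u + x v)\<^sup>2)"
    using fin W by (intro sum.cong refl sum.mono_neutral_right) (auto simp: z)
  finally show ?thesis unfolding signless_form_def adj by simp
qed

section \<open>Fractional decompositions and the spectral bound\<close>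

text \<open>The form is linear in the adjacency entries, and these decompose: on an edge of
  \<open>G\<close> the relevant weights sum to 1, and a non-edge of \<open>G\<close> is a non-edge
  of every \<open>Gs i\<close>.\<close>

lemma signless_form_decomposition:
  assumes "fractional_decomposition G r Gs \<alpha>"
  shows "signless_form G x = (\<Sum>i=1..r. \<alpha> i * signless_form (Gs i) x)"
proof -
  have sub: "verts (Gs i) = verts G" "edges (Gs i) \<subseteq> edges G" if "i \<in> {1..r}" for i
    using assms that unfolding fractional_decomposition_def spanning_subgraph_def by auto
  have adj: "adj G u v = (\<Sum>i=1..r. \<alpha> i * adj (Gs i) u v)" for u v
  proof (cases "{u, v} \<in> edges G")
    case True
    have "(\<Sum>i=1..r. \<alpha> i * adj (Gs i) u v) = (\<Sum>i | i \<in> {1..r} \<and> {u, v} \<in> edges (Gs i). \<alpha> i)"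
      by (subst sum.inter_filter) (auto simp: adj_def intro!: sum.cong)
    also have "\<dots> = 1" using assms True unfolding fractional_decomposition_def by blast
    finally show ?thesis using True by (simp add: adj_def)
  next
    case False
    then have "{u, v} \<notin> edges (Gs i)" if "i \<in> {1..r}" for i using sub that by blast
    then show ?thesis using False by (simp add: adj_def)
  qed
  have "signless_form G x =
      (\<Sum>u\<in>verts G. \<Sum>v\<in>verts G. \<Sum>i=1..r. \<alpha> i * (adj (Gs i) u v * (x u + x v)\<^sup>2))"
    unfolding signless_form_def adj by (simp add: sum_distrib_right mult.assoc)
  also have "\<dots> = (\<Sum>u\<in>verts G. \<Sum>i=1..r. \<Sum>v\<in>verts G. \<alpha> i * (adj (Gs i) u v * (x u + x v)\<^sup>2))"
    by (intro sum.cong refl sum.swap)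
  also have "\<dots> = (\<Sum>i=1..r. \<Sum>u\<in>verts G. \<Sum>v\<in>verts G. \<alpha> i * (adj (Gs i) u v * (x u + x v)\<^sup>2))"
    by (rule sum.swap)
  also have "\<dots> = (\<Sum>i=1..r. \<alpha> i * signless_form (Gs i) x)"
    unfolding signless_form_def using sub(1) by (simp add: sum_distrib_left)
  finally show ?thesis .
qed

theorem theorem2p2:
  fixes G :: "'a sgraph" and Gs :: "nat \<Rightarrow> 'a sgraph" and \<alpha> :: "nat \<Rightarrow> real"
    and H :: "nat \<Rightarrow> 'b sgraph" and s :: "nat \<Rightarrow> real" and k r t :: nat
  assumes "simple_graph G" and "regular k G"
    and "homogeneous_fractional_decomposition G r Gs \<alpha> t H s"
  shows "delta G \<ge> (\<Sum>j=1..t. delta (H j) * s j)"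
proof -
  let ?iso = "\<lambda>i j. graph_iso (remove_isolated (Gs i)) (H j)"
  let ?W = "\<lambda>i. verts (remove_isolated (Gs i))"
  have dec: "fractional_decomposition G r Gs \<alpha>"
    and H: "\<And>j. j \<in> {1..t} \<Longrightarrow> simple_graph (H j) \<and> (\<exists>d. regular d (H j))"
    and noniso: "\<And>j j'. j \<in> {1..t} \<Longrightarrow> j' \<in> {1..t} \<Longrightarrow> j \<noteq> j' \<Longrightarrow> \<not> graph_iso (H j) (H j')"
    and ex: "\<And>i. i \<in> {1..r} \<Longrightarrow> \<exists>j\<in>{1..t}. ?iso i j"
    and s: "\<And>j v. j \<in> {1..t} \<Longrightarrow> v \<in> verts G \<Longrightarrow>
      s j = (\<Sum>i | i \<in> {1..r} \<and> ?iso i j \<and> v \<in> ?W i. \<alpha> i)"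
    using assms(3) unfolding homogeneous_fractional_decomposition_def by blast+
  have \<alpha>: "0 \<le> \<alpha> i" and sub: "verts (Gs i) = verts G" "edges (Gs i) \<subseteq> edges G"
    if "i \<in> {1..r}" for i
    using dec that unfolding fractional_decomposition_def spanning_subgraph_def by auto
  have fin: "finite (verts G)" using assms(1) by (simp add: simple_graph_def)
  obtain x where pos: "0 < (\<Sum>v\<in>verts G. (x v)\<^sup>2)"
    and x: "signless_form G x = 2 * delta G * (\<Sum>v\<in>verts G. (x v)\<^sup>2)"
    using delta_attained[OF assms(1,2)] .
  \<comment> \<open>Extending the weights by 0 replaces the conditional sums defining
    \<open>s j\<close> by full sums over \<open>{1..r}\<close>, which can be exchanged with the sums
    over \<open>j\<close> and \<open>v\<close>.\<close>
  let ?w = "\<lambda>i j v. if ?iso i j \<and> v \<in> ?W i then \<alpha> i else 0"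
  have part: "(\<Sum>j=1..t. 2 * delta (H j) * (\<Sum>v\<in>verts G. ?w i j v * (x v)\<^sup>2))
      \<le> \<alpha> i * signless_form (Gs i) x" if i: "i \<in> {1..r}" for i
  proof -
    obtain j0 where j0: "j0 \<in> {1..t}" "?iso i j0" using ex[OF i] by blast
    \<comment> \<open>Two graphs \<open>H j\<close> isomorphic to the same
      \<open>remove_isolated (Gs i)\<close> would be isomorphic to each other. Hence each
      \<open>i\<close> contributes to a single \<open>j\<close>, and the sum over \<open>j\<close>
      collapses to \<open>j0\<close>.\<close>
    have uniq: "j = j0" if "j \<in> {1..t}" "?iso i j" for j
      using that j0 noniso graph_iso_sym graph_iso_trans by blast
    have "simple_graph (Gs i)" using assms(1) sub[OF i] by (auto simp: simple_graph_def)
    then have form: "signless_form (remove_isolated (Gs i)) x = signless_form (Gs i) x"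
      by (rule signless_form_remove_isolated)
    have sq: "(\<Sum>v\<in>verts G. ?w i j0 v * (x v)\<^sup>2) = \<alpha> i * (\<Sum>v\<in>?W i. (x v)\<^sup>2)"
    proof -
      have "(\<Sum>v\<in>verts G. ?w i j0 v * (x v)\<^sup>2) = (\<Sum>v\<in>?W i. ?w i j0 v * (x v)\<^sup>2)"
        using fin sub(1)[OF i] by (intro sum.mono_neutral_right) (auto simp: remove_isolated_def)
      then show ?thesis using j0 by (simp add: sum_distrib_left)
    qed
    have "(\<Sum>v\<in>verts G. ?w i j v * (x v)\<^sup>2) = 0" if "j \<in> {1..t} - {j0}" for j
      using that uniq[of j] by (intro sum.neutral) auto
    then have "(\<Sum>j=1..t. 2 * delta (H j) * (\<Sum>v\<in>verts G. ?w i j v * (x v)\<^sup>2))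
        = (\<Sum>j\<in>{j0}. 2 * delta (H j) * (\<Sum>v\<in>verts G. ?w i j v * (x v)\<^sup>2))"
      using j0(1) by (intro sum.mono_neutral_right) auto
    also have "\<dots> = \<alpha> i * (2 * delta (H j0) * (\<Sum>v\<in>?W i. (x v)\<^sup>2))"
      using sq by simp
    also have "\<dots> \<le> \<alpha> i * signless_form (Gs i) x"
      using delta_le_signless_form_iso[OF j0(2)] H[OF j0(1)] \<alpha>[OF i]
      by (intro mult_left_mono) (auto simp flip: form)
    finally show ?thesis .
  qed
  have s': "(\<Sum>i=1..r. ?w i j v) = s j" if "j \<in> {1..t}" "v \<in> verts G" for j v
    unfolding s[OF that] by (subst sum.inter_filter) auto
  \<comment> \<open>Homogeneity enters here: the total weight is the same \<open>s j\<close> at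
    every vertex and factors out of the sum of squares.\<close>
  have weight: "(\<Sum>v\<in>verts G. (\<Sum>i=1..r. ?w i j v) * (x v)\<^sup>2) = s j * (\<Sum>v\<in>verts G. (x v)\<^sup>2)"
    if "j \<in> {1..t}" for j
    unfolding sum_distrib_left by (intro sum.cong refl) (simp only: s'[OF that])
  \<comment> \<open>The bound to be proved, multiplied by twice the squared norm of
    \<open>x\<close>, is regrouped by \<open>i\<close> so that \<open>part\<close> applies to each
    \<open>Gs i\<close> separately.\<close>
  have "2 * (\<Sum>j=1..t. delta (H j) * s j) * (\<Sum>v\<in>verts G. (x v)\<^sup>2)
      = (\<Sum>j=1..t. 2 * delta (H j) * (\<Sum>v\<in>verts G. (\<Sum>i=1..r. ?w i j v) * (x v)\<^sup>2))"
    unfolding sum_distrib_left[of 2] sum_distrib_right[of _ "{1..t}"]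
    by (intro sum.cong refl) (simp only: weight mult.assoc)
  also have "\<dots> = (\<Sum>j=1..t. 2 * delta (H j) * (\<Sum>i=1..r. \<Sum>v\<in>verts G. ?w i j v * (x v)\<^sup>2))"
    unfolding sum_distrib_right by (intro sum.cong refl arg_cong2[where f = "(*)"] sum.swap)
  also have "\<dots> = (\<Sum>i=1..r. \<Sum>j=1..t. 2 * delta (H j) * (\<Sum>v\<in>verts G. ?w i j v * (x v)\<^sup>2))"
    unfolding sum_distrib_left[of _ _ "{1..r}"] by (rule sum.swap)
  also have "\<dots> \<le> (\<Sum>i=1..r. \<alpha> i * signless_form (Gs i) x)"
    by (intro sum_mono part)
  also have "\<dots> = 2 * delta G * (\<Sum>v\<in>verts G. (x v)\<^sup>2)"
    unfolding signless_form_decomposition[OF dec, symmetric] by (rule x)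
  finally show ?thesis using pos by simp
qed

end
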